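(* Let $d>1$ be an integer, let $A$ be a torsion-free abelian group of finite rank, and let $\mathbb N^d\overset{\alpha}{\curvearrowright}A$ be a left action by group endomorphisms. Then $h_{alg}(\alpha)=0$.
   Context: $\mathbb N^d$ is the additive monoid of $d$-tuples of non-negative integers; it is a cancellative amenable monoid. A left action $\mathbb N^d\overset{\alpha}{\curvearrowright}A$ is a monoid homomorphism from $\mathbb N^d$ to $(\mathrm{End}(A),\circ)$, so in particular $\alpha(0)=\mathrm{id}_A$. The rank of a torsion-free abelian group $A$ is $\dim_{\mathbb Q}(\mathbb Q\otimes A)$. A right Følner net of a semigroup $S$ is a net $(F_i)_{i\in I}$ of non-empty finite subsets of $S$ with $\lim_{i\in I}|F_is\setminus F_i|/|F_i|=0$ for every $s\in S$. For an action $\alpha$ of $S$ on $A$, non-empty finite $X\subseteq A$ and non-empty finite $F\subseteq S$ put $T_F(\alpha,X)=\sum_{s\in F}\alpha(s)(X)$ (sum of subsets). Set $H_{alg}(\alpha,X)=\lim_{i\in I}\frac{\log|T_{F_i}(\alpha,X)|}{|F_i|}$ for any right Følner net $(F_i)_{i\in I}$ of $S$; for cancellative right amenable $S$ such nets exist and the limit is known to exist, to be finite, and not to depend on the net. Define $h_{alg}(\alpha)=\sup\{H_{alg}(\alpha,X):X\subseteq A\text{ non-empty finite}\}\in[0,\infty]$. *)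

theory Defs
  imports "HOL-Analysis.Analysis" "HOL-Library.Multiset" "HOL-Library.Set_Algebras"
begin

section \<open>Torsion-free abelian groups of finite rank\<close>

definition torsion_free :: "'a::ab_group_add itself \<Rightarrow> bool" where
  "torsion_free _ \<longleftrightarrow> (\<forall>(n::nat) (a::'a). n > 0 \<longrightarrow> (\<Sum>i<n. a) = 0 \<longrightarrow> a = 0)"

text \<open>The tensor product of the rationals with \<open>A\<close> over the integers. A multiset of pairs
  \<open>(q, a)\<close> stands for the formal sum of the symbols \<open>q \<otimes> a\<close>, and \<open>tensor_rel\<close> is the smallest
  congruence making \<open>\<otimes>\<close> additive in each argument; the rule \<open>zero\<close> makes the quotient of the
  free commutative monoid a group. That \<open>\<otimes>\<close> is balanced over the integers follows from
  biadditivity.\<close>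

inductive tensor_rel :: "(rat \<times> 'a::ab_group_add) multiset \<Rightarrow> (rat \<times> 'a) multiset \<Rightarrow> bool" where
  refl: "tensor_rel x x"
| sym: "tensor_rel x y \<Longrightarrow> tensor_rel y x"
| trans: "tensor_rel x y \<Longrightarrow> tensor_rel y z \<Longrightarrow> tensor_rel x z"
| add: "tensor_rel x y \<Longrightarrow> tensor_rel (x + z) (y + z)"
| zero: "tensor_rel {#(0, a)#} {#}"
| add_left: "tensor_rel {#(q + r, a)#} {#(q, a), (r, a)#}"
| add_right: "tensor_rel {#(q, a + b)#} {#(q, a), (q, b)#}"

lemma equivp_tensor_rel: "equivp (tensor_rel :: (rat \<times> 'a::ab_group_add) multiset \<Rightarrow> _)"
  by (rule equivpI) (auto simp: reflp_def symp_def transp_def intro: tensor_rel.intros)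

quotient_type (overloaded) 'a rat_tensor = "(rat \<times> 'a::ab_group_add) multiset" / tensor_rel
  by (rule equivp_tensor_rel)

lemma tensor_rel_add:
  assumes "tensor_rel x y" "tensor_rel u v"
  shows "tensor_rel (x + u) (y + v)"
proof -
  have "tensor_rel (x + u) (y + u)" using assms(1) by (rule tensor_rel.add)
  moreover have "tensor_rel (u + y) (v + y)" using assms(2) by (rule tensor_rel.add)
  ultimately show ?thesis by (metis add.commute tensor_rel.trans)
qed

lemma tensor_rel_scale:
  "tensor_rel x y \<Longrightarrow>
    tensor_rel (image_mset (\<lambda>(r, a). (q * r, a)) x) (image_mset (\<lambda>(r, a). (q * r, a)) y)"
  by (induction rule: tensor_rel.induct)
    (auto simp: distrib_left intro: tensor_rel.intros tensor_rel_add)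

lemma tensor_rel_scale_add:
  "tensor_rel (image_mset (\<lambda>(r, a). ((p + q) * r, a)) x)
     (image_mset (\<lambda>(r, a). (p * r, a)) x + image_mset (\<lambda>(r, a). (q * r, a)) x)"
proof (induction x)
  case empty
  show ?case by (simp add: tensor_rel.refl)
next
  case (add z x)
  obtain r a where z: "z = (r, a)" by fastforce
  have "tensor_rel {#((p + q) * r, a)#} {#(p * r, a), (q * r, a)#}"
    by (simp add: distrib_right tensor_rel.add_left)
  from tensor_rel_add[OF this add] show ?case
    by (simp add: z add_mset_commute)
qed

lemma tensor_rel_scale_zero: "tensor_rel (image_mset (\<lambda>(r, a). (0 * r, a)) x) {#}"
proof (induction x)
  case empty
  show ?case by (simp add: tensor_rel.refl)
next
  case (add z x)
  obtain r a where z: "z = (r, a)" by fastforce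
  from tensor_rel_add[OF tensor_rel.zero[of a] add] show ?case
    by (simp add: z)
qed

lift_definition tensor_scale :: "rat \<Rightarrow> 'a::ab_group_add rat_tensor \<Rightarrow> 'a rat_tensor"
  is "\<lambda>q. image_mset (\<lambda>(r, a). (q * r, a))"
  by (rule tensor_rel_scale)

instantiation rat_tensor :: (ab_group_add) ab_group_add
begin

lift_definition zero_rat_tensor :: "'a rat_tensor" is "{#}" .

lift_definition plus_rat_tensor :: "'a rat_tensor \<Rightarrow> 'a rat_tensor \<Rightarrow> 'a rat_tensor" is "(+)"
  by (rule tensor_rel_add)

definition uminus_rat_tensor :: "'a rat_tensor \<Rightarrow> 'a rat_tensor" where
  "- x = tensor_scale (- 1) x"

definition minus_rat_tensor :: "'a rat_tensor \<Rightarrow> 'a rat_tensor \<Rightarrow> 'a rat_tensor" where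
  "x - y = x + - (y :: 'a rat_tensor)"

instance
proof
  fix x y z :: "'a rat_tensor"
  show "x + y + z = x + (y + z)"
    by transfer (simp add: add.assoc tensor_rel.refl)
  show "x + y = y + x"
    by transfer (simp add: add.commute tensor_rel.refl)
  show "0 + x = x"
    by transfer (simp add: tensor_rel.refl)
  have "tensor_rel (image_mset (\<lambda>(r, a). (- 1 * r, a)) u + u) {#}"
    for u :: "(rat \<times> 'a) multiset"
  proof -
    have "tensor_rel (image_mset (\<lambda>(r, a). (- 1 * r, a)) u + u)
        (image_mset (\<lambda>(r, a). ((- 1 + 1) * r, a)) u)"
      using tensor_rel_scale_add[of "- 1" 1 u] by (auto intro: tensor_rel.sym)
    then show ?thesis
      using tensor_rel_scale_zero[of u] by (auto intro: tensor_rel.trans)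
  qed
  then show "- x + x = 0"
    unfolding uminus_rat_tensor_def by transfer
  show "x - y = x + - y"
    by (rule minus_rat_tensor_def)
qed

end

global_interpretation rat_tensor: vector_space "tensor_scale :: rat \<Rightarrow> 'a::ab_group_add rat_tensor \<Rightarrow> _"
proof
  fix p q :: rat and x y :: "'a rat_tensor"
  show "tensor_scale p (x + y) = tensor_scale p x + tensor_scale p y"
    by transfer (simp add: tensor_rel.refl)
  show "tensor_scale (p + q) x = tensor_scale p x + tensor_scale q x"
    by transfer (rule tensor_rel_scale_add)
  show "tensor_scale p (tensor_scale q x) = tensor_scale (p * q) x"
    by transfer (simp add: image_mset.compositionality comp_def case_prod_unfold mult.assoc
        tensor_rel.refl)
  show "tensor_scale 1 x = x"
    by transfer (simp add: tensor_rel.refl)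
qed

text \<open>The library function \<open>dim\<close> returns 0 on infinite-dimensional spaces, hence the case
  distinction.\<close>

definition abelian_rank :: "'a::ab_group_add itself \<Rightarrow> enat" where
  "abelian_rank _ =
    (if \<exists>B. finite_dimensional_vector_space (tensor_scale :: rat \<Rightarrow> 'a rat_tensor \<Rightarrow> _) B
     then enat (rat_tensor.dim (UNIV :: 'a rat_tensor set)) else \<infinity>)"


section \<open>Algebraic entropy\<close>

definition left_action :: "('s::monoid_add \<Rightarrow> 'a::ab_group_add \<Rightarrow> 'a) \<Rightarrow> bool" where
  "left_action \<alpha> \<longleftrightarrow>
    (\<forall>s. Modules.additive (\<alpha> s)) \<and> \<alpha> 0 = id \<and> (\<forall>s t. \<alpha> (s + t) = \<alpha> s \<circ> \<alpha> t)"

text \<open>A net \<open>(F\<^sub>i)\<close> is given by the family \<open>F\<close> together with the filter \<open>N\<close> of tails of its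
  directed index set. Semigroups are written additively.\<close>

definition right_Folner_net :: "('i \<Rightarrow> 's::semigroup_add set) \<Rightarrow> 'i filter \<Rightarrow> bool" where
  "right_Folner_net F N \<longleftrightarrow>
    N \<noteq> bot \<and> (\<forall>\<^sub>F i in N. finite (F i) \<and> F i \<noteq> {}) \<and>
    (\<forall>s. ((\<lambda>i. real (card ((\<lambda>t. t + s) ` F i - F i)) / real (card (F i))) \<longlongrightarrow> 0) N)"

definition trajectory :: "('s \<Rightarrow> 'a \<Rightarrow> 'a) \<Rightarrow> 's set \<Rightarrow> 'a set \<Rightarrow> 'a::ab_group_add set" where
  "trajectory \<alpha> F X = (\<Sum>s\<in>F. \<alpha> s ` X)"

text \<open>\<open>l\<close> is the common limit along all right Folner nets. By the lemma below it is enough to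
  quantify over filters on the subsets of the semigroup, as a net with any other index type can
  be replaced by its image there.\<close>

definition is_H_alg :: "('s::semigroup_add \<Rightarrow> 'a::ab_group_add \<Rightarrow> 'a) \<Rightarrow> 'a set \<Rightarrow> real \<Rightarrow> bool" where
  "is_H_alg \<alpha> X l \<longleftrightarrow>
    (\<forall>N. right_Folner_net (\<lambda>F. F) N \<longrightarrow>
      ((\<lambda>F. ln (real (card (trajectory \<alpha> F X))) / real (card F)) \<longlongrightarrow> l) N)"

lemma is_H_alg_net:
  assumes "is_H_alg \<alpha> X l" and "right_Folner_net F N"
  shows "((\<lambda>i. ln (real (card (trajectory \<alpha> (F i) X))) / real (card (F i))) \<longlongrightarrow> l) N"
proof -
  have "right_Folner_net (\<lambda>F. F) (filtermap F N)"
    using assms(2)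
    by (simp add: right_Folner_net_def filtermap_bot_iff eventually_filtermap filterlim_filtermap)
  with assms(1) have
    "((\<lambda>F. ln (real (card (trajectory \<alpha> F X))) / real (card F)) \<longlongrightarrow> l) (filtermap F N)"
    unfolding is_H_alg_def by blast
  then show ?thesis
    unfolding filterlim_filtermap .
qed

definition H_alg :: "('s::semigroup_add \<Rightarrow> 'a::ab_group_add \<Rightarrow> 'a) \<Rightarrow> 'a set \<Rightarrow> real" where
  "H_alg \<alpha> X = (THE l. is_H_alg \<alpha> X l)"

definition h_alg :: "('s::semigroup_add \<Rightarrow> 'a::ab_group_add \<Rightarrow> 'a) \<Rightarrow> ereal" where
  "h_alg \<alpha> = (SUP X\<in>{X. finite X \<and> X \<noteq> {}}. ereal (H_alg \<alpha> X))"

end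

theory Submission
  imports Defs "HOL-Real_Asymp.Real_Asymp"
begin

text \<open>Finite rank yields a finite set \<open>E\<close> such that every element of the group has a positive
  multiple in the subgroup generated by \<open>E\<close>. In these coordinates the generators of the action
  become integer matrices over a common denominator, so along the cube \<open>[0, m)\<^sup>d\<close> both the
  denominators and the coefficients occurring in the trajectory are at most exponential in \<open>m\<close>;
  the trajectory therefore has \<open>exp (O(m))\<close> elements, and \<open>O(m) / m\<^sup>d \<rightarrow> 0\<close> because \<open>d > 1\<close>.
  An arbitrary Folner set is tiled by translates of a fixed cube up to a negligible part, and
  translation does not increase the size of a trajectory, so the entropy along any Folner net is
  at most that of the cube.\<close>

section \<open>Integer multiples\<close>

text \<open>Written without a case distinction on the sign: at least one of the two sums is empty
  because \<open>nat\<close> truncates at 0. Positive multiples have the same form as in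
  \<open>torsion_free\<close>.\<close>

definition int_scale :: "int \<Rightarrow> 'a::ab_group_add \<Rightarrow> 'a" where
  "int_scale k a = (\<Sum>i<nat k. a) - (\<Sum>i<nat (- k). a)"

lemma sum_const_lessThan_add:
  "(\<Sum>i<m + n. a) = (\<Sum>i<m. a) + (\<Sum>i<n. a :: 'a::ab_group_add)" for m n :: nat
  by (induction n) (simp_all add: algebra_simps)

lemma int_scale_add: "int_scale (j + k) a = int_scale j a + int_scale k a"
proof -
  \<comment> \<open>Moving the truncated negative parts across makes the identity hold for all signs
    of \<open>j\<close> and \<open>k\<close> at once.\<close>
  have "nat (j + k) + (nat (- j) + nat (- k)) = nat (- (j + k)) + (nat j + nat k)"
    by linarith
  then have "(\<Sum>i<nat (j + k) + (nat (- j) + nat (- k)). a)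
      = (\<Sum>i<nat (- (j + k)) + (nat j + nat k). a)"
    by (rule arg_cong)
  then show ?thesis
    unfolding int_scale_def sum_const_lessThan_add by (simp add: algebra_simps)
qed

lemma int_scale_1: "int_scale 1 a = a"
  by (simp add: int_scale_def lessThan_Suc)

lemma int_scale_0: "int_scale 0 a = 0"
  by (simp add: int_scale_def)

lemma int_scale_mult: "int_scale (j * k) a = int_scale j (int_scale k a)"
proof (induction j rule: int_induct[where k = 0])
  case base
  show ?case by (simp add: int_scale_0)
next
  case (step1 i)
  then show ?case by (simp add: distrib_right int_scale_add int_scale_1)
next
  case (step2 i)
  then show ?case
    using int_scale_add[of "i - 1" 1 "int_scale k a"] int_scale_add[of "(i - 1) * k" k a]
    by (simp add: left_diff_distrib int_scale_1 algebra_simps)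
qed

interpretation int_scale: module int_scale
  by unfold_locales
    (simp_all add: int_scale_add int_scale_mult int_scale_1, simp add: int_scale_def sum.distrib)

lemma additive_int_scale: "Modules.additive f \<Longrightarrow> f (int_scale k a) = int_scale k (f a)"
  by (simp add: int_scale_def additive.diff additive.sum)

text \<open>This is how torsion-freeness enters: multiplying by a common denominator moves a
  trajectory into a lattice without changing its cardinality.\<close>

lemma inj_int_scale:
  assumes "torsion_free TYPE('a::ab_group_add)" "k > 0"
  shows "inj (int_scale k :: 'a \<Rightarrow> 'a)"
proof (rule injI)
  fix a b :: 'a
  assume "int_scale k a = int_scale k b"
  then have "int_scale k (a - b) = 0"
    by (simp add: int_scale.scale_right_diff_distrib)
  then have "(\<Sum>i<nat k. a - b) = 0"
    using assms(2) by (simp add: int_scale_def)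
  then have "a - b = 0"
    using assms unfolding torsion_free_def by (metis zero_less_nat_eq)
  then show "a = b" by simp
qed


section \<open>Integral evaluation of tensors\<close>

text \<open>If \<open>D\<close> clears all denominators in \<open>x\<close>, the floors are exact
  and the value is a group element whose image in the tensor product is \<open>D\<close> times the
  class of \<open>x\<close>. For other \<open>D\<close> the floor merely makes the function
  total.\<close>

definition floor_eval :: "int \<Rightarrow> (rat \<times> 'a::ab_group_add) multiset \<Rightarrow> 'a" where
  "floor_eval D x = (\<Sum>(q, a)\<in>#x. int_scale \<lfloor>of_int D * q\<rfloor> a)"

lemma rat_denominator: "\<exists>D a. D > 0 \<and> of_int D * q = (of_int a :: rat)"
proof (cases q)
  case (Fract a b)
  then show ?thesis
    by (intro exI[of _ b] exI[of _ a]) (auto simp: Fract_of_int_quotient)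
qed

text \<open>Only multiples of a common denominator are compared, since the floor is additive only
  on integers.\<close>

lemma tensor_rel_floor_eval:
  "tensor_rel x y \<Longrightarrow> \<exists>D>0. \<forall>k>0. floor_eval (k * D) x = floor_eval (k * D) y"
proof (induction rule: tensor_rel.induct)
  case (trans x y z)
  then obtain D D' where D: "D > 0" "\<forall>k>0. floor_eval (k * D) x = floor_eval (k * D) y"
    and D': "D' > 0" "\<forall>k>0. floor_eval (k * D') y = floor_eval (k * D') z"
    by blast
  have "floor_eval (k * (D * D')) x = floor_eval (k * (D * D')) z" if "k > 0" for k
    using D(2)[rule_format, of "k * D'"] D'(2)[rule_format, of "k * D"] that D(1) D'(1)
    by (simp add: mult_ac)
  then show ?case
    using D(1) D'(1) by (intro exI[of _ "D * D'"]) simp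
next
  case (add x y z)
  then show ?case by (auto simp: floor_eval_def)
next
  case (add_left q r a)
  obtain D b where D: "D > 0" "of_int D * q = (of_int b :: rat)"
    using rat_denominator by blast
  obtain D' c where D': "D' > 0" "of_int D' * r = (of_int c :: rat)"
    using rat_denominator by blast
  \<comment> \<open>The factor \<open>D * D'\<close> clears the denominators of \<open>q\<close>,
    \<open>r\<close> and \<open>q + r\<close>, so every floor is taken of an integer.\<close>
  have "floor_eval (k * (D * D')) {#(q + r, a)#} = floor_eval (k * (D * D')) {#(q, a), (r, a)#}"
    for k
  proof -
    have q: "of_int (k * (D * D')) * q = (of_int (k * D' * b) :: rat)"
      using D(2) by (simp add: mult_ac)
    have r: "of_int (k * (D * D')) * r = (of_int (k * D * c) :: rat)"
      using D'(2) by (simp add: mult_ac)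
    have qr: "of_int (k * (D * D')) * (q + r) = (of_int (k * D' * b + k * D * c) :: rat)"
      unfolding distrib_left q r by simp
    show ?thesis
      unfolding floor_eval_def by (simp only: image_mset_add_mset image_mset_empty
        sum_mset.add_mset sum_mset.empty prod.case q r qr floor_of_int int_scale_add add_0_right)
  qed
  then show ?case
    using D(1) D'(1) by (intro exI[of _ "D * D'"]) simp
qed (auto simp: floor_eval_def int_scale.scale_right_distrib intro: exI[of _ 1])


section \<open>Bounded integer combinations\<close>

text \<open>A ball for the sup norm of coefficients in the subgroup generated by \<open>E\<close>.
  Elements of \<open>E\<close> may be dependent, so counting coefficient vectors bounds its size
  only from above.\<close>

definition coeff_ball :: "'a set \<Rightarrow> int \<Rightarrow> 'a::ab_group_add set" where
  "coeff_ball E K = (\<lambda>c. \<Sum>e\<in>E. int_scale (c e) e) ` {c. \<forall>e\<in>E. \<bar>c e\<bar> \<le> K}"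

lemma coeff_ballE:
  assumes "y \<in> coeff_ball E K"
  obtains c where "y = (\<Sum>e\<in>E. int_scale (c e) e)" "\<And>e. e \<in> E \<Longrightarrow> \<bar>c e\<bar> \<le> K"
  using assms unfolding coeff_ball_def by auto

lemma coeff_ballI:
  "y = (\<Sum>e\<in>E. int_scale (c e) e) \<Longrightarrow> (\<And>e. e \<in> E \<Longrightarrow> \<bar>c e\<bar> \<le> K) \<Longrightarrow> y \<in> coeff_ball E K"
  unfolding coeff_ball_def by auto

lemma coeff_ball_mono: "K \<le> K' \<Longrightarrow> coeff_ball E K \<subseteq> coeff_ball E K'"
  unfolding coeff_ball_def by (auto dest: order_trans)

lemma zero_in_coeff_ball: "K \<ge> 0 \<Longrightarrow> 0 \<in> coeff_ball E K"
  by (rule coeff_ballI[where c = "\<lambda>_. 0"]) (simp_all add: int_scale_0)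

lemma coeff_ball_add:
  assumes "y \<in> coeff_ball E K" "z \<in> coeff_ball E K'"
  shows "y + z \<in> coeff_ball E (K + K')"
proof -
  obtain b where b: "y = (\<Sum>e\<in>E. int_scale (b e) e)" "\<And>e. e \<in> E \<Longrightarrow> \<bar>b e\<bar> \<le> K"
    using assms(1) by (blast elim: coeff_ballE)
  obtain c where c: "z = (\<Sum>e\<in>E. int_scale (c e) e)" "\<And>e. e \<in> E \<Longrightarrow> \<bar>c e\<bar> \<le> K'"
    using assms(2) by (blast elim: coeff_ballE)
  show ?thesis
  proof (rule coeff_ballI)
    show "y + z = (\<Sum>e\<in>E. int_scale (b e + c e) e)"
      by (simp add: b(1) c(1) int_scale_add sum.distrib)
    show "\<bar>b e + c e\<bar> \<le> K + K'" if "e \<in> E" for e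
      using b(2)[OF that] c(2)[OF that] by linarith
  qed
qed

lemma coeff_ball_sum:
  "finite I \<Longrightarrow> (\<And>i. i \<in> I \<Longrightarrow> f i \<in> coeff_ball E (K i)) \<Longrightarrow> (\<Sum>i\<in>I. f i) \<in> coeff_ball E (\<Sum>i\<in>I. K i)"
  by (induction rule: finite_induct) (simp_all add: zero_in_coeff_ball coeff_ball_add)

lemma coeff_ball_scale:
  assumes "y \<in> coeff_ball E K"
  shows "int_scale j y \<in> coeff_ball E (\<bar>j\<bar> * K)"
proof -
  obtain c where c: "y = (\<Sum>e\<in>E. int_scale (c e) e)" "\<And>e. e \<in> E \<Longrightarrow> \<bar>c e\<bar> \<le> K"
    using assms by (blast elim: coeff_ballE)
  show ?thesis
  proof (rule coeff_ballI)
    show "int_scale j y = (\<Sum>e\<in>E. int_scale (j * c e) e)"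
      by (simp add: c(1) int_scale.scale_sum_right)
    show "\<bar>j * c e\<bar> \<le> \<bar>j\<bar> * K" if "e \<in> E" for e
      using c(2)[OF that] by (simp add: abs_mult mult_left_mono)
  qed
qed

text \<open>Each coefficient has \<open>2 * K + 1\<close> possible values. Restricting coefficient
  functions to \<open>E\<close> leaves the sums unchanged and makes the set of functions
  finite.\<close>

lemma finite_card_coeff_ball:
  assumes "finite E" "K \<ge> 0"
  shows "finite (coeff_ball E K)" "card (coeff_ball E K) \<le> nat (2 * K + 1) ^ card E"
proof -
  let ?P = "PiE E (\<lambda>_. {- K..K})"
  have sub: "coeff_ball E K \<subseteq> (\<lambda>c. \<Sum>e\<in>E. int_scale (c e) e) ` ?P"
  proof
    fix y assume "y \<in> coeff_ball E K"
    then obtain c where c: "y = (\<Sum>e\<in>E. int_scale (c e) e)" "\<And>e. e \<in> E \<Longrightarrow> \<bar>c e\<bar> \<le> K"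
      by (blast elim: coeff_ballE)
    have "restrict c E \<in> ?P"
      using c(2) by (auto simp: abs_le_iff) force
    moreover have "y = (\<Sum>e\<in>E. int_scale (restrict c E e) e)"
      using c(1) by simp
    ultimately show "y \<in> (\<lambda>c. \<Sum>e\<in>E. int_scale (c e) e) ` ?P"
      by blast
  qed
  have fin: "finite ?P"
    using assms(1) by (intro finite_PiE) auto
  then show "finite (coeff_ball E K)"
    using sub finite_subset by blast
  have "card (coeff_ball E K) \<le> card ?P"
    using sub fin by (meson card_image_le card_mono finite_imageI order_trans)
  also have "\<dots> = nat (2 * K + 1) ^ card E"
    using assms by (simp add: card_PiE)
  finally show "card (coeff_ball E K) \<le> nat (2 * K + 1) ^ card E" .
qed

section \<open>From finite rank to a lattice with torsion quotient\<close>

text \<open>The tensors with a representative supported on \<open>E\<close> form a subspace. It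
  contains a basis once \<open>E\<close> collects the group elements occurring in chosen
  representatives of the basis vectors.\<close>

lemma finite_rank_support:
  assumes "abelian_rank TYPE('a::ab_group_add) < \<infinity>"
  obtains E :: "'a::ab_group_add set" where "finite E"
    "\<And>t :: 'a::ab_group_add rat_tensor. \<exists>x. t = abs_rat_tensor x \<and> snd ` set_mset x \<subseteq> E"
proof -
  obtain B :: "'a rat_tensor set" where
    "finite_dimensional_vector_space (tensor_scale :: rat \<Rightarrow> 'a rat_tensor \<Rightarrow> _) B"
    using assms unfolding abelian_rank_def by (auto split: if_splits)
  then interpret fd: finite_dimensional_vector_space "tensor_scale :: rat \<Rightarrow> 'a rat_tensor \<Rightarrow> _" B .
  have fin: "finite B" and span: "rat_tensor.span B = UNIV"
    using fd.finite_Basis fd.span_Basis by auto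
  define E where "E = (\<Union>b\<in>B. snd ` set_mset (rep_rat_tensor b))"
  let ?S = "{abs_rat_tensor x | x. snd ` set_mset x \<subseteq> E}"
  have "rat_tensor.subspace ?S"
  proof (rule rat_tensor.subspaceI)
    show "0 \<in> ?S"
      unfolding zero_rat_tensor_def by (auto intro!: exI[of _ "{#}"])
  next
    fix s t assume "s \<in> ?S" "t \<in> ?S"
    then obtain x y where "s = abs_rat_tensor x" "snd ` set_mset x \<subseteq> E"
      "t = abs_rat_tensor y" "snd ` set_mset y \<subseteq> E"
      by blast
    then have "s + t = abs_rat_tensor (x + y)" "snd ` set_mset (x + y) \<subseteq> E"
      by (simp_all add: plus_rat_tensor.abs_eq image_Un)
    then show "s + t \<in> ?S"
      by blast
  next
    fix q t assume "t \<in> ?S"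
    then obtain x where x: "t = abs_rat_tensor x" "snd ` set_mset x \<subseteq> E"
      by blast
    have "snd ` set_mset (image_mset (\<lambda>(r, a). (q * r, a)) x) \<subseteq> E"
      using x(2) by force
    then show "tensor_scale q t \<in> ?S"
      unfolding x(1) tensor_scale.abs_eq by blast
  qed
  moreover have "B \<subseteq> ?S"
  proof
    fix b assume "b \<in> B"
    then have "snd ` set_mset (rep_rat_tensor b) \<subseteq> E"
      unfolding E_def by (rule UN_upper)
    then show "b \<in> ?S"
      by (intro CollectI exI[of _ "rep_rat_tensor b"] conjI)
        (rule Quotient3_abs_rep[OF Quotient3_rat_tensor, symmetric])
  qed
  ultimately have "?S = UNIV"
    using span rat_tensor.span_minimal by blast
  then have "\<exists>x. t = abs_rat_tensor x \<and> snd ` set_mset x \<subseteq> E" for t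
    by blast
  moreover have "finite E"
    using fin by (simp add: E_def)
  ultimately show ?thesis
    using that by blast
qed

lemma floor_eval_in_coeff_ball:
  assumes "finite E" "snd ` set_mset x \<subseteq> E"
  shows "\<exists>K\<ge>0. floor_eval D x \<in> coeff_ball E K"
  using assms(2)
proof (induction x)
  case empty
  show ?case
    by (rule exI[of _ 0]) (simp add: floor_eval_def zero_in_coeff_ball)
next
  case (add z x)
  obtain q a where z: "z = (q, a)" by fastforce
  obtain K where K: "K \<ge> 0" "floor_eval D x \<in> coeff_ball E K"
    using add by auto
  let ?n = "\<lfloor>of_int D * q\<rfloor>"
  have a: "a \<in> E" using add.prems z by simp
  have "int_scale ?n a \<in> coeff_ball E \<bar>?n\<bar>"
  proof (rule coeff_ballI)
    have "(\<Sum>e\<in>E. int_scale (if e = a then ?n else 0) e)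
        = (\<Sum>e\<in>E. if e = a then int_scale ?n a else 0)"
      by (intro sum.cong) (auto simp: int_scale_0)
    then show "int_scale ?n a = (\<Sum>e\<in>E. int_scale (if e = a then ?n else 0) e)"
      using assms(1) a by simp
  qed simp
  from coeff_ball_add[OF this K(2)] show ?case
    using K(1) by (intro exI[of _ "\<bar>?n\<bar> + K"]) (simp add: floor_eval_def z)
qed

text \<open>Represent the tensor of 1 and \<open>a\<close> by a formal sum supported on
  \<open>E\<close>. Evaluating both representatives at a suitable \<open>D\<close> turns their
  equivalence into an equation in the group, with \<open>D\<close> times \<open>a\<close> on one
  side.\<close>

lemma finite_rank_lattice:
  assumes "abelian_rank TYPE('a::ab_group_add) < \<infinity>"
  obtains E :: "'a::ab_group_add set" where "finite E"
    "\<And>a. \<exists>N K. N > 0 \<and> K \<ge> 0 \<and> int_scale N a \<in> coeff_ball E K"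
proof -
  obtain E :: "'a set" where E: "finite E"
    "\<And>t :: 'a rat_tensor. \<exists>x. t = abs_rat_tensor x \<and> snd ` set_mset x \<subseteq> E"
    using finite_rank_support[OF assms] by blast
  have "\<exists>N K. N > 0 \<and> K \<ge> 0 \<and> int_scale N a \<in> coeff_ball E K" for a :: 'a
  proof -
    obtain x where x: "abs_rat_tensor {#(1, a)#} = abs_rat_tensor x" "snd ` set_mset x \<subseteq> E"
      using E(2) by blast
    have "tensor_rel {#(1, a)#} x"
      using x(1) by (simp add: rat_tensor.abs_eq_iff)
    from tensor_rel_floor_eval[OF this] obtain D where
      D: "D > 0" "floor_eval (1 * D) {#(1, a)#} = floor_eval (1 * D) x"
      by (meson zero_less_one)
    then have "int_scale D a = floor_eval D x"
      by (simp add: floor_eval_def)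
    moreover obtain K where "K \<ge> 0" "floor_eval D x \<in> coeff_ball E K"
      using floor_eval_in_coeff_ball[OF E(1) x(2)] by blast
    ultimately show ?thesis
      using D(1) by metis
  qed
  with E(1) show ?thesis
    using that by blast
qed

lemma common_denominator:
  assumes "\<And>a. \<exists>N K. N > 0 \<and> K \<ge> 0 \<and> int_scale N a \<in> coeff_ball E K" and "finite Y"
  shows "\<exists>N K. N > 0 \<and> K \<ge> 0 \<and> (\<forall>y\<in>Y. int_scale N y \<in> coeff_ball E K)"
  using assms(2)
proof (induction rule: finite_induct)
  case empty
  show ?case by (intro exI[of _ 1]) simp
next
  case (insert a Y)
  obtain N K where N: "N > 0" "K \<ge> 0" "\<forall>y\<in>Y. int_scale N y \<in> coeff_ball E K"
    using insert.IH by blast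
  obtain M L where M: "M > 0" "L \<ge> 0" "int_scale M a \<in> coeff_ball E L"
    using assms(1) by blast
  \<comment> \<open>Each radius is scaled by the other denominator, and the sum of the two scaled
    radii dominates both.\<close>
  have "int_scale (M * N) y \<in> coeff_ball E (M * K + N * L)" if "y \<in> Y" for y
    using coeff_ball_scale[of "int_scale N y" E K M] N M that
      coeff_ball_mono[of "M * K" "M * K + N * L" E]
    by auto
  moreover have "int_scale (M * N) a \<in> coeff_ball E (M * K + N * L)"
    using coeff_ball_scale[of "int_scale M a" E L N] N M
      coeff_ball_mono[of "N * L" "M * K + N * L" E]
    by (auto simp: mult.commute)
  ultimately show ?case
    using N M by (intro exI[of _ "M * N"] exI[of _ "M * K + N * L"]) auto
qed


section \<open>Growth of trajectories\<close>

text \<open>A bound for a matrix-vector product: \<open>N\<close> times \<open>f\<close> acts on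
  coefficients by an integer matrix of size \<open>card E\<close> with entries at most
  \<open>C\<close> in absolute value.\<close>

lemma additive_coeff_ball:
  assumes "Modules.additive f" "finite E" "\<And>e. e \<in> E \<Longrightarrow> int_scale N (f e) \<in> coeff_ball E C"
    and "C \<ge> 0" "z \<in> coeff_ball E K"
  shows "int_scale N (f z) \<in> coeff_ball E (int (card E) * C * K)"
proof -
  obtain c where c: "z = (\<Sum>e\<in>E. int_scale (c e) e)" "\<And>e. e \<in> E \<Longrightarrow> \<bar>c e\<bar> \<le> K"
    using assms(5) by (blast elim: coeff_ballE)
  have "int_scale (c e) (int_scale N (f e)) \<in> coeff_ball E (C * K)" if "e \<in> E" for e
  proof -
    have "\<bar>c e\<bar> * C \<le> C * K"
      using c(2)[OF that] assms(4) by (simp add: mult.commute mult_left_mono)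
    then show ?thesis
      using coeff_ball_scale[OF assms(3)[OF that], of "c e"] coeff_ball_mono by blast
  qed
  then have "(\<Sum>e\<in>E. int_scale (c e) (int_scale N (f e))) \<in> coeff_ball E (\<Sum>e\<in>E. C * K)"
    by (intro coeff_ball_sum assms(2))
  moreover have "int_scale N (f z) = (\<Sum>e\<in>E. int_scale (c e) (int_scale N (f e)))"
    using assms(1) unfolding c(1)
    by (simp add: additive.sum additive_int_scale int_scale.scale_sum_right
        flip: int_scale_mult) (simp add: mult.commute)
  ultimately show ?thesis
    by (simp add: mult.assoc)
qed

text \<open>The word length with respect to the generators \<open>axis i 1\<close>.\<close>

definition height :: "nat ^ 'd::finite \<Rightarrow> nat" where
  "height s = (\<Sum>i\<in>UNIV. s $ i)"

lemma height_SucE: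
  assumes "height s = Suc n"
  obtains i t where "s = axis i 1 + t" "height t = n"
proof -
  obtain i where i: "s $ i > 0"
    using assms unfolding height_def by (metis gr0I nat.distinct(1) sum.neutral)
  \<comment> \<open>The truncated subtraction is exact, because coordinate \<open>i\<close> of
    \<open>s\<close> is positive.\<close>
  define t where "t = (\<chi> j. s $ j - axis i 1 $ j)"
  have s: "s = axis i 1 + t"
    using i by (auto simp: vec_eq_iff t_def axis_def)
  have "height s = (\<Sum>j\<in>UNIV. if j = i then 1 else 0) + height t"
    unfolding height_def by (subst s) (simp add: sum.distrib axis_def eq_commute)
  then show ?thesis
    using assms s that by simp
qed

lemma left_action_additive: "left_action \<alpha> \<Longrightarrow> Modules.additive (\<alpha> s)"
  by (simp add: left_action_def)

text \<open>Each generator in a word for \<open>s\<close> costs one factor \<open>N\<close> in the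
  denominator and one factor \<open>card E * C\<close> in the coefficients. The extra factor
  \<open>N\<close> is the denominator of \<open>x\<close> itself.\<close>

lemma left_action_coeff_ball:
  fixes \<alpha> :: "nat ^ 'd::finite \<Rightarrow> 'a::ab_group_add \<Rightarrow> 'a"
  assumes \<alpha>: "left_action \<alpha>" and E: "finite E"
    and gen: "\<And>i e. e \<in> E \<Longrightarrow> int_scale N (\<alpha> (axis i 1) e) \<in> coeff_ball E C" and C: "C \<ge> 0"
    and x: "int_scale N x \<in> coeff_ball E K"
  shows "int_scale (N ^ Suc (height s)) (\<alpha> s x)
    \<in> coeff_ball E ((int (card E) * C) ^ height s * K)"
proof (induction "height s" arbitrary: s)
  case 0
  then have "s = 0" by (simp add: height_def vec_eq_iff)
  then show ?case using \<alpha> x 0 by (simp flip: 0 add: left_action_def)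
next
  case (Suc n)
  obtain i t where s: "s = axis i 1 + t" and t: "height t = n"
    using height_SucE[of s n] Suc.hyps(2) by metis
  let ?f = "\<alpha> (axis i 1)"
  have f: "Modules.additive ?f" using \<alpha> by (rule left_action_additive)
  have "int_scale N (?f (int_scale (N ^ Suc n) (\<alpha> t x)))
      \<in> coeff_ball E (int (card E) * C * ((int (card E) * C) ^ n * K))"
    using Suc.hyps(1)[of t] t by (intro additive_coeff_ball f E gen C) auto
  moreover have "\<alpha> s x = ?f (\<alpha> t x)"
    using \<alpha> by (simp add: left_action_def s)
  then have eq: "int_scale (N ^ Suc (Suc n)) (\<alpha> s x)
      = int_scale N (?f (int_scale (N ^ Suc n) (\<alpha> t x)))"
    by (simp only: additive_int_scale[OF f] power_Suc[of N "Suc n"] int_scale_mult)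
  ultimately show ?case
    unfolding Suc.hyps(2)[symmetric] eq by (simp only: power_Suc mult.assoc)
qed

text \<open>One multiplier clears the denominators of the whole trajectory and sends it injectively
  into a coefficient ball, whose points are counted. It matters that \<open>q\<close> and
  \<open>r\<close> depend on neither \<open>F\<close> nor \<open>L\<close>.\<close>

lemma card_trajectory_height:
  fixes \<alpha> :: "nat ^ 'd::finite \<Rightarrow> 'a::ab_group_add \<Rightarrow> 'a"
  assumes tf: "torsion_free TYPE('a)" and rank: "abelian_rank TYPE('a) < \<infinity>"
    and \<alpha>: "left_action \<alpha>" and X: "finite X"
  obtains q r :: nat where "q > 0"
    "\<And>F L. finite F \<Longrightarrow> (\<And>s. s \<in> F \<Longrightarrow> height s \<le> L) \<Longrightarrow>
      card (trajectory \<alpha> F X) \<le> (2 * (card F * q ^ Suc L) + 1) ^ r"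
proof -
  obtain E :: "'a set" where E: "finite E"
    "\<And>a. \<exists>N K. N > 0 \<and> K \<ge> 0 \<and> int_scale N a \<in> coeff_ball E K"
    using finite_rank_lattice[OF rank] by blast
  \<comment> \<open>One denominator is to serve both the points of \<open>X\<close> and the matrices
    of the generators.\<close>
  have "finite (X \<union> (\<lambda>(i, e). \<alpha> (axis i 1) e) ` (UNIV \<times> E))"
    using X E(1) by simp
  from common_denominator[OF E(2) this] obtain N K where N: "N > 0" "K \<ge> 0"
    and K: "\<And>x. x \<in> X \<Longrightarrow> int_scale N x \<in> coeff_ball E K"
      "\<And>i e. e \<in> E \<Longrightarrow> int_scale N (\<alpha> (axis i 1) e) \<in> coeff_ball E K"
    by (auto simp: ball_Un)
  \<comment> \<open>A single base dominating \<open>N\<close>, \<open>int (card E) * K\<close> and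
    \<open>K\<close>, so that all three kinds of factor combine into one power.\<close>
  define q where "q = N + int (card E) * K + K"
  have q: "q > 0" "N \<le> q" "int (card E) * K \<le> q" "K \<le> q"
    using N by (auto simp: q_def add_pos_nonneg)
  have "card (trajectory \<alpha> F X) \<le> (2 * (card F * nat q ^ Suc L) + 1) ^ card E"
    if F: "finite F" "\<And>s. s \<in> F \<Longrightarrow> height s \<le> L" for F L
  proof -
    let ?B = "coeff_ball E (int (card F) * q ^ Suc L)"
    have ball: "int_scale (N ^ Suc L) (\<alpha> s x) \<in> coeff_ball E (q ^ Suc L)"
      if "s \<in> F" "x \<in> X" for s x
    proof -
      let ?h = "height s"
      \<comment> \<open>Elements of height below \<open>L\<close> are multiplied by further factors
        \<open>N\<close> to reach the common exponent; each of these is also at most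
        \<open>q\<close>.\<close>
      let ?k = "L - ?h"
      have h: "?k + ?h = L" using F(2)[OF that(1)] by simp
      have "int_scale (N ^ ?k) (int_scale (N ^ Suc ?h) (\<alpha> s x))
          \<in> coeff_ball E (\<bar>N ^ ?k\<bar> * ((int (card E) * K) ^ ?h * K))"
        by (intro coeff_ball_scale left_action_coeff_ball \<alpha> E(1) K N(2) that)
      moreover have "\<bar>N ^ ?k\<bar> * ((int (card E) * K) ^ ?h * K) \<le> q ^ ?k * (q ^ ?h * q)"
        using N q by (intro mult_mono power_mono) (auto simp: power_mono)
      moreover have "q ^ ?k * (q ^ ?h * q) = q ^ Suc L"
        by (metis h mult.assoc power_Suc2 power_add)
      moreover have "N ^ ?k * N ^ Suc ?h = N ^ Suc L"
        by (metis h add_Suc_right power_add)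
      ultimately show ?thesis
        using coeff_ball_mono by (metis int_scale_mult subsetD)
    qed
    have "int_scale (N ^ Suc L) ` trajectory \<alpha> F X \<subseteq> ?B"
    proof safe
      fix y assume "y \<in> trajectory \<alpha> F X"
      then obtain f where y: "y = (\<Sum>s\<in>F. f s)" and f: "\<And>s. s \<in> F \<Longrightarrow> f s \<in> \<alpha> s ` X"
        unfolding trajectory_def set_sum_alt[OF F(1)] by auto
      have "int_scale (N ^ Suc L) (f s) \<in> coeff_ball E (q ^ Suc L)" if s: "s \<in> F" for s
      proof -
        obtain x where "x \<in> X" "f s = \<alpha> s x" using f[OF s] by blast
        then show ?thesis using ball[OF s] by simp
      qed
      then have "(\<Sum>s\<in>F. int_scale (N ^ Suc L) (f s)) \<in> coeff_ball E (\<Sum>s\<in>F. q ^ Suc L)"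
        by (intro coeff_ball_sum F(1))
      then show "int_scale (N ^ Suc L) y \<in> ?B"
        by (simp add: y int_scale.scale_sum_right)
    qed
    moreover have "inj_on (int_scale (N ^ Suc L)) (trajectory \<alpha> F X)"
      using inj_int_scale[OF tf, of "N ^ Suc L"] N(1) by (auto intro: inj_on_subset)
    ultimately have "card (trajectory \<alpha> F X) \<le> card ?B"
      using finite_card_coeff_ball(1)[OF E(1)] q(1) by (intro card_inj_on_le) auto
    also have "\<dots> \<le> nat (2 * (int (card F) * q ^ Suc L) + 1) ^ card E"
      using finite_card_coeff_ball(2)[OF E(1)] q(1) by simp
    also have "nat (2 * (int (card F) * q ^ Suc L) + 1) = 2 * (card F * nat q ^ Suc L) + 1"
      using q(1) by (simp add: nat_add_distrib nat_mult_distrib nat_power_eq del: power_Suc)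
    finally show ?thesis .
  qed
  with q(1) show ?thesis
    using that[of "nat q" "card E"] by simp
qed


section \<open>Tiling by cubes\<close>

lemma card_set_plus_le:
  fixes A B :: "'a::ab_group_add set"
  assumes "finite A" "finite B"
  shows "card (A + B) \<le> card A * card B"
  using assms card_image_le[of "A \<times> B" "\<lambda>(a, b). a + b"]
  by (simp add: set_plus_image card_cartesian_product)

section \<open>Submultiplicativity and translation of trajectories\<close>

lemma trajectory_Un:
  "finite F \<Longrightarrow> finite G \<Longrightarrow> F \<inter> G = {} \<Longrightarrow>
    trajectory \<alpha> (F \<union> G) X = trajectory \<alpha> F X + trajectory \<alpha> G X"
  unfolding trajectory_def by (rule sum.union_disjoint)

text \<open>For infinite \<open>F\<close> the sum takes its default value \<open>{0}\<close>, which
  is finite as well.\<close>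

lemma finite_trajectory: "finite X \<Longrightarrow> finite (trajectory \<alpha> F X)"
  unfolding trajectory_def
  by (induction F rule: infinite_finite_induct) (auto simp: finite_set_plus set_zero)

lemma trajectory_nonempty: "X \<noteq> {} \<Longrightarrow> trajectory \<alpha> F X \<noteq> {}"
  unfolding trajectory_def
  by (induction F rule: infinite_finite_induct) (auto simp: set_plus_def set_zero)

lemma card_trajectory_pos: "finite X \<Longrightarrow> X \<noteq> {} \<Longrightarrow> card (trajectory \<alpha> F X) > 0"
  by (simp add: card_gt_0_iff finite_trajectory trajectory_nonempty)

lemma card_trajectory_Un:
  "finite F \<Longrightarrow> finite G \<Longrightarrow> F \<inter> G = {} \<Longrightarrow> finite X \<Longrightarrow>
    card (trajectory \<alpha> (F \<union> G) X) \<le> card (trajectory \<alpha> F X) * card (trajectory \<alpha> G X)"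
  by (simp add: trajectory_Un card_set_plus_le finite_trajectory)

lemma card_trajectory_UN:
  assumes "finite C" "disjoint_family_on G C" "finite X"
    and "\<And>c. c \<in> C \<Longrightarrow> finite (G c)" "\<And>c. c \<in> C \<Longrightarrow> card (trajectory \<alpha> (G c) X) \<le> b"
  shows "card (trajectory \<alpha> (\<Union>c\<in>C. G c) X) \<le> b ^ card C"
  using assms
proof (induction rule: finite_induct)
  case empty
  show ?case by (simp add: trajectory_def set_zero)
next
  case (insert c C)
  have disj: "G c \<inter> (\<Union>c\<in>C. G c) = {}" "disjoint_family_on G C"
    using insert.prems(1) insert.hyps(2) by (auto simp: disjoint_family_on_def)
  have "card (trajectory \<alpha> (G c \<union> (\<Union>c\<in>C. G c)) X)
      \<le> card (trajectory \<alpha> (G c) X) * card (trajectory \<alpha> (\<Union>c\<in>C. G c) X)"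
    using insert disj(1) by (intro card_trajectory_Un) auto
  also have "\<dots> \<le> b * b ^ card C"
    using insert disj(2) by (intro mult_mono) auto
  finally show ?case using insert.hyps by simp
qed

text \<open>Singletons serve as the cells of a partition. This crude bound is for the part of a
  Folner set that the tiling leaves uncovered.\<close>

lemma card_trajectory_le:
  assumes "finite F" "finite X"
  shows "card (trajectory \<alpha> F X) \<le> card X ^ card F"
  using card_trajectory_UN[of F "\<lambda>s. {s}" X \<alpha> "card X"] assms
  by (auto simp: trajectory_def disjoint_family_on_def card_image_le)

lemma additive_image_set_plus:
  "Modules.additive f \<Longrightarrow> f ` (A + B) = f ` A + f ` B"
  unfolding set_plus_image image_image
  by (force simp: additive.add image_iff)

text \<open>Since \<open>\<alpha> (c + s)\<close> is \<open>\<alpha> c\<close> after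
  \<open>\<alpha> s\<close>, a translate has as its trajectory an image of the original one. Hence
  no tile has a larger trajectory than the cube.\<close>

lemma trajectory_translate:
  fixes \<alpha> :: "nat ^ 'd::finite \<Rightarrow> 'a::ab_group_add \<Rightarrow> 'a"
  assumes "left_action \<alpha>"
  shows "trajectory \<alpha> ((+) c ` B) X = \<alpha> c ` trajectory \<alpha> B X"
proof -
  have c: "Modules.additive (\<alpha> c)"
    using assms by (rule left_action_additive)
  have "\<alpha> c ` (\<Sum>s\<in>B. \<alpha> s ` X) = (\<Sum>s\<in>B. \<alpha> c ` \<alpha> s ` X)"
    by (induction B rule: infinite_finite_induct)
      (simp_all add: additive_image_set_plus[OF c] set_zero additive.zero[OF c])
  then show ?thesis
    using assms unfolding trajectory_def left_action_def
    by (subst sum.reindex) (auto simp: image_comp comp_def)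
qed

section \<open>Cubes and tilings of finite sets\<close>

definition cube :: "nat \<Rightarrow> (nat ^ 'd::finite) set" where
  "cube m = {v. \<forall>i. v $ i < m}"

lemma finite_card_cube:
  "finite (cube m :: (nat ^ 'd::finite) set)" "card (cube m :: (nat ^ 'd) set) = m ^ CARD('d)"
proof -
  have cube: "(cube m :: (nat ^ 'd) set) = vec_lambda ` PiE UNIV (\<lambda>_. {..<m})"
  proof
    show "cube m \<subseteq> vec_lambda ` PiE (UNIV :: 'd set) (\<lambda>_. {..<m})"
    proof
      fix v :: "nat ^ 'd" assume "v \<in> cube m"
      then have "vec_nth v \<in> PiE UNIV (\<lambda>_. {..<m})" by (auto simp: cube_def)
      then show "v \<in> vec_lambda ` PiE (UNIV :: 'd set) (\<lambda>_. {..<m})"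
        by (metis image_eqI vec_nth_inverse)
    qed
  qed (auto simp: cube_def)
  have inj: "inj_on vec_lambda (PiE (UNIV :: 'd set) (\<lambda>_. {..<m}))"
    by (auto intro!: inj_onI simp: vec_lambda_inject)
  show "finite (cube m :: (nat ^ 'd) set)"
    unfolding cube by (intro finite_imageI finite_PiE) auto
  show "card (cube m :: (nat ^ 'd) set) = m ^ CARD('d)"
    unfolding cube card_image[OF inj] by (simp add: card_PiE)
qed

text \<open>The numerator of the quotient in \<open>right_Folner_net\<close>.\<close>

abbreviation escape :: "'s::semigroup_add set \<Rightarrow> 's \<Rightarrow> nat" where
  "escape F s \<equiv> card ((\<lambda>t. t + s) ` F - F)"

text \<open>Translation is injective, so \<open>F\<close> and its translate have equal size and
  their two differences do too.\<close>

lemma card_escape_outer: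
  fixes F :: "'s::cancel_semigroup_add set"
  assumes "finite F"
  shows "card (F - (\<lambda>t. t + s) ` F) = escape F s"
proof -
  have "card ((\<lambda>t. t + s) ` F) = card F"
    by (simp add: card_image inj_on_def)
  then show ?thesis
    using assms by (simp add: card_Diff_subset_Int Int_commute)
qed

lemma card_escape_inner:
  fixes F :: "'s::cancel_semigroup_add set"
  shows "card {c \<in> F. c + s \<notin> F} = escape F s"
proof -
  have "(\<lambda>t. t + s) ` F - F = (\<lambda>t. t + s) ` {c \<in> F. c + s \<notin> F}" by auto
  then show ?thesis by (simp add: card_image inj_on_def)
qed

text \<open>Take the cells of the grid of mesh \<open>m\<close> that lie inside \<open>F\<close>.
  For an uncovered point, either the corner of its cell is outside \<open>F\<close>, or the corner
  is in \<open>F\<close> and some translate of it within the cell is not; the two sums count these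
  cases.\<close>

lemma cube_tiling:
  fixes F :: "(nat ^ 'd::finite) set"
  assumes F: "finite F" and m: "m > 0"
  obtains C where "finite C" "disjoint_family_on (\<lambda>c. (+) c ` cube m) C"
    "(\<Union>c\<in>C. (+) c ` cube m) \<subseteq> F"
    "card (F - (\<Union>c\<in>C. (+) c ` cube m))
      \<le> (\<Sum>s\<in>cube m. escape F s) + card (cube m :: (nat ^ 'd) set) * (\<Sum>t\<in>cube m. escape F t)"
proof -
  define C where "C = {c \<in> F. (\<forall>i. m dvd c $ i) \<and> (+) c ` cube m \<subseteq> F}"
  let ?G = "\<Union>c\<in>C. (+) c ` cube m"
  \<comment> \<open>Coordinatewise division by \<open>m\<close> recovers the corner, as offsets are
    below \<open>m\<close>.\<close>
  have "c = c'" if "c \<in> C" "c' \<in> C" "s \<in> cube m" "s' \<in> cube m" "c + s = c' + s'" for c c' s s'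
  proof -
    have "c $ i = c' $ i" for i
    proof -
      have "c $ i + s $ i = c' $ i + s' $ i"
        using that(5) by (metis vector_add_component)
      moreover have "s $ i < m" "s' $ i < m" "m dvd c $ i" "m dvd c' $ i"
        using that by (auto simp: cube_def C_def)
      moreover obtain k k' where "c $ i = m * k" "c' $ i = m * k'"
        using calculation by (elim dvdE)
      ultimately have "(m * k + s $ i) div m = (m * k' + s' $ i) div m" "s $ i < m" "s' $ i < m"
        "c $ i = m * k" "c' $ i = m * k'"
        by auto
      then show ?thesis by simp
    qed
    then show ?thesis by (simp add: vec_eq_iff)
  qed
  then have disj: "disjoint_family_on (\<lambda>c. (+) c ` cube m) C"
    unfolding disjoint_family_on_def by blast
  have "F - ?G \<subseteq> (\<Union>s\<in>cube m. F - (\<lambda>t. t + s) ` F)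
      \<union> (\<Union>s\<in>cube m. \<Union>t\<in>cube m. (\<lambda>c. c + s) ` {c \<in> F. c + t \<notin> F})"
  proof
    fix f assume f: "f \<in> F - ?G"
    \<comment> \<open>\<open>c\<close> is the corner of the cell of \<open>f\<close>, and
      \<open>s\<close> the offset of \<open>f\<close> in that cell.\<close>
    define c where "c = (\<chi> i. m * (f $ i div m))"
    define s where "s = (\<chi> i. f $ i mod m)"
    have s: "s \<in> cube m" using m by (simp add: cube_def s_def)
    have fcs: "f = c + s" by (simp add: vec_eq_iff c_def s_def)
    show "f \<in> (\<Union>s\<in>cube m. F - (\<lambda>t. t + s) ` F)
      \<union> (\<Union>s\<in>cube m. \<Union>t\<in>cube m. (\<lambda>c. c + s) ` {c \<in> F. c + t \<notin> F})"
    proof (cases "c \<in> F")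
      case False
      then have "f \<in> F - (\<lambda>t. t + s) ` F" using f fcs by auto
      with s show ?thesis by blast
    next
      case True
      have "c \<notin> C" using f s fcs by blast
      then obtain t where "t \<in> cube m" "c + t \<notin> F"
        using True by (auto simp: C_def c_def)
      with s fcs True show ?thesis by blast
    qed
  qed
  then have "card (F - ?G) \<le> card ((\<Union>s\<in>cube m. F - (\<lambda>t. t + s) ` F)
      \<union> (\<Union>s\<in>cube m. \<Union>t\<in>cube m. (\<lambda>c. c + s) ` {c \<in> F. c + t \<notin> F}))"
    using F by (intro card_mono) (auto simp: finite_card_cube)
  also have "\<dots> \<le> card (\<Union>s\<in>cube m. F - (\<lambda>t. t + s) ` F)
      + card (\<Union>s\<in>cube m. \<Union>t\<in>cube m. (\<lambda>c. c + s) ` {c \<in> F. c + t \<notin> F})"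
    by (rule card_Un_le)
  also have "card (\<Union>s\<in>cube m. F - (\<lambda>t. t + s) ` F) \<le> (\<Sum>s\<in>cube m. escape F s)"
    using card_UN_le[OF finite_card_cube(1), of "\<lambda>s. F - (\<lambda>t. t + s) ` F" m]
    by (simp only: card_escape_outer[OF F])
  also have "card (\<Union>s\<in>cube m. \<Union>t\<in>cube m. (\<lambda>c. c + s) ` {c \<in> F. c + t \<notin> F})
      \<le> (\<Sum>s\<in>(cube m :: (nat ^ 'd) set). \<Sum>t\<in>cube m. escape F t)"
  proof (rule order_trans[OF card_UN_le[OF finite_card_cube(1)]], rule sum_mono)
    fix s :: "nat ^ 'd"
    show "card (\<Union>t\<in>cube m. (\<lambda>c. c + s) ` {c \<in> F. c + t \<notin> F}) \<le> (\<Sum>t\<in>cube m. escape F t)"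
      using card_UN_le[OF finite_card_cube(1), of "\<lambda>t. (\<lambda>c. c + s) ` {c \<in> F. c + t \<notin> F}" m]
      by (simp add: card_image inj_on_def card_escape_inner)
  qed
  finally have "card (F - ?G) \<le> (\<Sum>s\<in>cube m. escape F s)
      + card (cube m :: (nat ^ 'd) set) * (\<Sum>t\<in>cube m. escape F t)"
    by simp
  moreover have "finite C" using F by (simp add: C_def)
  moreover have "?G \<subseteq> F" by (auto simp: C_def)
  ultimately show ?thesis using that disj by blast
qed

text \<open>By submultiplicativity every tile contributes at most the logarithm for the cube, and
  every uncovered point at most \<open>ln (card X)\<close>. Disjointness bounds the number of tiles
  by \<open>card F\<close> over the volume of the cube.\<close>

lemma ln_card_trajectory_tiling:
  fixes \<alpha> :: "nat ^ 'd::finite \<Rightarrow> 'a::ab_group_add \<Rightarrow> 'a"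
  assumes \<alpha>: "left_action \<alpha>" and X: "finite X" "X \<noteq> {}" and F: "finite F" "F \<noteq> {}"
    and m: "m > 0"
  shows "ln (card (trajectory \<alpha> F X)) / card F
    \<le> ln (card (trajectory \<alpha> (cube m) X)) / real (m ^ CARD('d))
      + ln (card X) * (1 + real (m ^ CARD('d))) * (\<Sum>s\<in>cube m. escape F s / card F)"
proof -
  obtain C where C: "finite C" "disjoint_family_on (\<lambda>c. (+) c ` cube m) C"
    "(\<Union>c\<in>C. (+) c ` cube m) \<subseteq> F"
    "card (F - (\<Union>c\<in>C. (+) c ` cube m))
      \<le> (\<Sum>s\<in>cube m. escape F s) + card (cube m :: (nat ^ 'd) set) * (\<Sum>t\<in>cube m. escape F t)"
    using cube_tiling[OF F(1) m] by blast
  let ?G = "\<Union>c\<in>C. (+) c ` cube m"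
  let ?b = "card (trajectory \<alpha> (cube m) X)"
  let ?M = "m ^ CARD('d)"
  have b: "?b > 0" and x: "card X > 0" using card_trajectory_pos[OF X] X by (auto simp: card_gt_0_iff)
  have Gfin: "finite ?G" using C(3) F(1) by (rule finite_subset)
  have cardC: "card C * ?M \<le> card F"
  proof -
    have "card ?G = (\<Sum>c\<in>C. card ((+) c ` (cube m :: (nat ^ 'd) set)))"
      using C(1,2) by (intro card_UN_disjoint) (auto simp: finite_card_cube disjoint_family_on_def)
    also have "\<dots> = card C * ?M"
      by (simp add: card_image finite_card_cube)
    finally show ?thesis using card_mono[OF F(1) C(3)] by simp
  qed
  have "card (trajectory \<alpha> F X) = card (trajectory \<alpha> (?G \<union> (F - ?G)) X)"
    using C(3) by (simp add: Un_absorb1)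
  also have "\<dots> \<le> card (trajectory \<alpha> ?G X) * card (trajectory \<alpha> (F - ?G) X)"
    using F X Gfin by (intro card_trajectory_Un) auto
  also have "\<dots> \<le> ?b ^ card C * card X ^ card (F - ?G)"
    using C(1,2) X F
    by (intro mult_mono card_trajectory_UN card_trajectory_le)
      (auto simp: finite_card_cube trajectory_translate[OF \<alpha>] card_image_le finite_trajectory)
  finally have "ln (card (trajectory \<alpha> F X)) \<le> ln (real (?b ^ card C * card X ^ card (F - ?G)))"
    using card_trajectory_pos[OF X] by (subst ln_le_cancel_iff) (auto simp: b x simp del: of_nat_mult)
  also have "\<dots> = card C * ln ?b + card (F - ?G) * ln (card X)"
    using b x by (simp add: ln_mult ln_realpow)
  finally have ln: "ln (card (trajectory \<alpha> F X)) \<le> card C * ln ?b + card (F - ?G) * ln (card X)" .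
  have "card C * ln ?b / card F \<le> ln ?b / ?M"
  proof -
    have "real (card C) * real ?M \<le> card F"
      using cardC by (metis of_nat_le_iff of_nat_mult)
    \<comment> \<open>As \<open>?b\<close> is at least 1, its logarithm is nonnegative and preserves
      the inequality.\<close>
    then have "ln ?b * (real (card C) * real ?M) \<le> ln ?b * card F"
      using b by (intro mult_left_mono) auto
    then show ?thesis
      using F m by (simp add: field_simps card_gt_0_iff)
  qed
  moreover have "card (F - ?G) * ln (card X) / card F
      \<le> ln (card X) * (1 + real ?M) * (\<Sum>s\<in>cube m. escape F s / card F)"
  proof -
    have "real (card (F - ?G)) \<le> (1 + real ?M) * (\<Sum>s\<in>cube m. real (escape F s))"
      using C(4) unfolding finite_card_cube(2)
      by (simp add: distrib_right flip: of_nat_sum of_nat_mult of_nat_add of_nat_power)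
    then have "ln (card X) * card (F - ?G) \<le> ln (card X) * ((1 + real ?M) * (\<Sum>s\<in>cube m. real (escape F s)))"
      using x by (intro mult_left_mono) auto
    then show ?thesis
      by (simp add: divide_right_mono mult_ac flip: sum_divide_distrib)
  qed
  ultimately show ?thesis
    using divide_right_mono[OF ln, of "card F"] by (simp add: add_divide_distrib)
qed


section \<open>Entropy\<close>

lemma cube_entropy_tendsto_0:
  fixes \<alpha> :: "nat ^ 'd::finite \<Rightarrow> 'a::ab_group_add \<Rightarrow> 'a"
  assumes d: "CARD('d) > 1" and tf: "torsion_free TYPE('a)"
    and rank: "abelian_rank TYPE('a) < \<infinity>" and \<alpha>: "left_action \<alpha>" and X: "finite X" "X \<noteq> {}"
  shows "(\<lambda>m. ln (card (trajectory \<alpha> (cube m) X)) / real (m ^ CARD('d))) \<longlonglongrightarrow> 0"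
proof -
  obtain q r :: nat where q: "q > 0" and bound:
    "\<And>F L. finite F \<Longrightarrow> (\<And>s. s \<in> F \<Longrightarrow> height s \<le> L) \<Longrightarrow>
      card (trajectory \<alpha> F X) \<le> (2 * (card F * q ^ Suc L) + 1) ^ r"
    using card_trajectory_height[OF tf rank \<alpha> X(1)] by blast
  define d where "d = real CARD('d)"
  \<comment> \<open>The numerator, linear in \<open>m\<close> up to a logarithm, is the logarithm of
    the counting bound; dividing by the square of \<open>m\<close> already gives limit 0.\<close>
  let ?u = "\<lambda>m. real r * (ln 3 + d * ln (real m) + (d * real m + 1) * ln q) / (real m)\<^sup>2"
  have nonneg: "0 \<le> ln (real (card (trajectory \<alpha> F X)))" for F
    using card_trajectory_pos[OF X, of \<alpha> F] by simp
  have upper: "eventually (\<lambda>m. ln (card (trajectory \<alpha> (cube m) X)) / real (m ^ CARD('d)) \<le> ?u m) sequentially"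
    using eventually_gt_at_top[of 0]
  proof eventually_elim
    case (elim m)
    let ?L = "CARD('d) * m"
    have "height s \<le> ?L" if "s \<in> cube m" for s :: "nat ^ 'd"
      using that sum_bounded_above[of UNIV "\<lambda>i. s $ i" m]
      by (force simp: cube_def height_def intro: less_imp_le)
    then have "card (trajectory \<alpha> (cube m) X) \<le> (2 * (m ^ CARD('d) * q ^ Suc ?L) + 1) ^ r"
      using bound[of "cube m" ?L] by (simp add: finite_card_cube)
    \<comment> \<open>Absorbing the summand 1 leaves a pure product, whose logarithm splits.\<close>
    also have "\<dots> \<le> (3 * (m ^ CARD('d) * q ^ Suc ?L)) ^ r"
    proof (rule power_mono)
      have "m ^ CARD('d) * q ^ Suc ?L > 0" using elim q by simp
      then show "2 * (m ^ CARD('d) * q ^ Suc ?L) + 1 \<le> 3 * (m ^ CARD('d) * q ^ Suc ?L)"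
        by linarith
    qed simp
    finally have "ln (card (trajectory \<alpha> (cube m) X)) \<le> ln (real ((3 * (m ^ CARD('d) * q ^ Suc ?L)) ^ r))"
      using card_trajectory_pos[OF X] elim q
      by (subst ln_le_cancel_iff) (auto simp del: of_nat_mult of_nat_power)
    also have "\<dots> = real r * (ln 3 + d * ln (real m) + (d * real m + 1) * ln q)"
      using elim q by (simp add: ln_mult ln_realpow d_def algebra_simps)
    finally have le: "ln (card (trajectory \<alpha> (cube m) X))
      \<le> real r * (ln 3 + d * ln (real m) + (d * real m + 1) * ln q)" .
    \<comment> \<open>Here the dimension being greater than 1 enters.\<close>
    have "m\<^sup>2 \<le> m ^ CARD('d)"
      using elim d by (intro power_increasing) auto
    then have "(real m)\<^sup>2 \<le> real (m ^ CARD('d))"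
      by (metis of_nat_le_iff of_nat_power)
    moreover have "0 \<le> ln (real (card (trajectory \<alpha> (cube m) X)))"
      by (rule nonneg)
    ultimately show ?case
      using le elim by (intro frac_le) auto
  qed
  have lim: "?u \<longlonglongrightarrow> 0"
    by real_asymp
  show ?thesis
    by (rule tendsto_sandwich[OF _ upper tendsto_const lim]) (simp add: nonneg)
qed

text \<open>Nonempty trajectories give the lower bound. For the upper bound a cube with small
  quotient is fixed first, and only then does \<open>F\<close> run along the net.\<close>

lemma is_H_alg_0:
  fixes \<alpha> :: "nat ^ 'd::finite \<Rightarrow> 'a::ab_group_add \<Rightarrow> 'a"
  assumes d: "CARD('d) > 1" and tf: "torsion_free TYPE('a)"
    and rank: "abelian_rank TYPE('a) < \<infinity>" and \<alpha>: "left_action \<alpha>" and X: "finite X" "X \<noteq> {}"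
  shows "is_H_alg \<alpha> X 0"
  unfolding is_H_alg_def
proof (intro allI impI)
  fix N :: "(nat ^ 'd) set filter"
  assume N: "right_Folner_net (\<lambda>F. F) N"
  show "((\<lambda>F. ln (card (trajectory \<alpha> F X)) / card F) \<longlongrightarrow> 0) N"
  proof (rule order_tendstoI)
    fix a :: real assume "a < 0"
    moreover have "ln (card (trajectory \<alpha> F X)) / card F \<ge> 0" for F
      using card_trajectory_pos[OF X, of \<alpha> F] by (intro divide_nonneg_nonneg) auto
    ultimately show "\<forall>\<^sub>F F in N. a < ln (card (trajectory \<alpha> F X)) / card F"
      by (intro always_eventually) (meson less_le_trans)
  next
    fix a :: real assume "0 < a"
    then have "\<forall>\<^sub>F m in sequentially. m > 0 \<and>
        ln (card (trajectory \<alpha> (cube m) X)) / real (m ^ CARD('d)) < a"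
      by (intro eventually_conj eventually_gt_at_top
          order_tendstoD(2)[OF cube_entropy_tendsto_0[OF d tf rank \<alpha> X]])
    then obtain m where m: "m > 0"
      and lt: "ln (card (trajectory \<alpha> (cube m) X)) / real (m ^ CARD('d)) < a"
      by (metis (mono_tags, lifting) eventually_happens' sequentially_bot)
    let ?u = "\<lambda>F. ln (card (trajectory \<alpha> (cube m) X)) / real (m ^ CARD('d))
      + ln (card X) * (1 + real (m ^ CARD('d))) * (\<Sum>s\<in>cube m. escape F s / card F)"
    \<comment> \<open>The cube stays fixed, so this is a finite sum of terms that tend to 0 by the
      Folner condition.\<close>
    have "((\<lambda>F. \<Sum>s\<in>cube m. escape F s / card F) \<longlongrightarrow> (\<Sum>s\<in>(cube m :: (nat ^ 'd) set). 0)) N"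
      using N unfolding right_Folner_net_def by (intro tendsto_sum) auto
    then have "(?u \<longlongrightarrow> ln (card (trajectory \<alpha> (cube m) X)) / real (m ^ CARD('d))
        + ln (card X) * (1 + real (m ^ CARD('d))) * 0) N"
      by (intro tendsto_intros) simp
    then have "\<forall>\<^sub>F F in N. ?u F < a"
      using lt by (intro order_tendstoD(2)) auto
    moreover have "\<forall>\<^sub>F F in N. finite F \<and> F \<noteq> {}"
      using N by (simp add: right_Folner_net_def)
    ultimately show "\<forall>\<^sub>F F in N. ln (card (trajectory \<alpha> F X)) / card F < a"
    proof eventually_elim
      case (elim F)
      then show ?case
        using ln_card_trajectory_tiling[OF \<alpha> X _ _ m, of F] by linarith
    qed
  qed
qed

text \<open>Some Folner net must exist, as otherwise every real would satisfy
  \<open>is_H_alg\<close> vacuously. What leaves the cube under translation by \<open>s\<close> lies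
  in a slightly larger cube, whose relative excess tends to 0.\<close>

lemma right_Folner_net_cube:
  "right_Folner_net (cube :: nat \<Rightarrow> (nat ^ 'd::finite) set) sequentially"
  unfolding right_Folner_net_def
proof (intro conjI allI)
  show "\<forall>\<^sub>F m in sequentially. finite (cube m :: (nat ^ 'd) set) \<and> (cube m :: (nat ^ 'd) set) \<noteq> {}"
    using eventually_gt_at_top[of 0]
  proof eventually_elim
    case (elim m)
    then have "(0 :: nat ^ 'd) \<in> cube m" by (simp add: cube_def)
    then show ?case by (auto simp: finite_card_cube)
  qed
next
  fix s :: "nat ^ 'd"
  \<comment> \<open>The height serves as a common upper bound for the coordinates of
    \<open>s\<close>.\<close>
  define k where "k = height s"
  have esc: "escape (cube m) s / card (cube m :: (nat ^ 'd) set) \<le> (1 + k / m) ^ CARD('d) - 1"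
    if "m > 0" for m
  proof -
    have "s $ i \<le> k" for i
      unfolding k_def height_def by (intro member_le_sum) auto
    then have "(\<lambda>t. t + s) ` cube m \<subseteq> cube (m + k)"
      by (auto simp: cube_def add_less_le_mono)
    then have "escape (cube m) s \<le> card (cube (m + k) - cube m :: (nat ^ 'd) set)"
      by (intro card_mono) (auto simp: finite_card_cube)
    also have "\<dots> = (m + k) ^ CARD('d) - m ^ CARD('d)"
      by (subst card_Diff_subset) (auto simp: finite_card_cube, auto simp: cube_def intro: less_le_trans)
    finally have "real (escape (cube m) s) \<le> real ((m + k) ^ CARD('d) - m ^ CARD('d))"
      by (simp only: of_nat_le_iff)
    also have "\<dots> = (real m + k) ^ CARD('d) - real m ^ CARD('d)"
      by (simp add: of_nat_diff power_mono)
    finally have "escape (cube m) s / real m ^ CARD('d)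
        \<le> ((real m + k) ^ CARD('d) - real m ^ CARD('d)) / real m ^ CARD('d)"
      by (rule divide_right_mono) simp
    also have "\<dots> = ((real m + k) / m) ^ CARD('d) - 1"
      using that by (simp add: diff_divide_distrib power_divide)
    also have "(real m + k) / m = 1 + k / m"
      using that by (simp add: add_divide_distrib)
    finally show ?thesis by (simp add: finite_card_cube)
  qed
  have "(\<lambda>m. real k / real m) \<longlonglongrightarrow> 0"
    by real_asymp
  then have "(\<lambda>m. (1 + real k / real m) ^ CARD('d) - 1) \<longlonglongrightarrow> (1 + 0) ^ CARD('d) - 1"
    by (intro tendsto_intros)
  then have lim: "(\<lambda>m. (1 + real k / real m) ^ CARD('d) - 1) \<longlonglongrightarrow> 0"
    by simp
  show "(\<lambda>m. escape (cube m) s / card (cube m :: (nat ^ 'd) set)) \<longlonglongrightarrow> 0"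
    by (rule tendsto_sandwich[OF _ eventually_mono[OF eventually_gt_at_top[of 0] esc]
          tendsto_const lim]) simp
qed simp

text \<open>Uniqueness of limits along the net of cubes justifies the description operator in
  \<open>H_alg\<close>.\<close>

lemma H_alg_eqI:
  fixes \<alpha> :: "nat ^ 'd::finite \<Rightarrow> 'a::ab_group_add \<Rightarrow> 'a"
  assumes "is_H_alg \<alpha> X l"
  shows "H_alg \<alpha> X = l"
  unfolding H_alg_def
proof (rule the_equality)
  fix l' assume "is_H_alg \<alpha> X l'"
  then show "l' = l"
    using is_H_alg_net[OF _ right_Folner_net_cube] assms
    by (intro tendsto_unique[OF sequentially_bot])
qed (rule assms)

theorem corollary5p5:
  fixes \<alpha> :: "nat ^ 'd::finite \<Rightarrow> 'a::ab_group_add \<Rightarrow> 'a"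
  assumes "CARD('d) > 1"
    and "torsion_free TYPE('a)"
    and "abelian_rank TYPE('a) < \<infinity>"
    and "left_action \<alpha>"
  shows "h_alg \<alpha> = 0"
proof -
  \<comment> \<open>Over an empty index set the supremum in \<open>ereal\<close> would be minus
    infinity instead of 0.\<close>
  have "{X :: 'a set. finite X \<and> X \<noteq> {}} \<noteq> {}" by blast
  moreover have "H_alg \<alpha> X = 0" if "finite X" "X \<noteq> {}" for X
    using H_alg_eqI[OF is_H_alg_0[OF assms that]] .
  moreover have "(SUP X\<in>{X. finite X \<and> X \<noteq> {}}. ereal (H_alg \<alpha> X))
      = (SUP X\<in>{X :: 'a set. finite X \<and> X \<noteq> {}}. 0)"
    using calculation(2) by (intro SUP_cong) auto
  ultimately show ?thesis
    unfolding h_alg_def by simp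
qed

end
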